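(* Consider the robust remanufacturing planning model with interval-matrix ambiguity sets $\mathcal{U}_{sk}=\{\pmb p(\cdot|s,k):\underline p(s'|s,k)\le p(s'|s,k)\le\bar p(s'|s,k)\ \forall s'\in\mathcal{S},\ \sum_{s'\in\mathcal{S}}p(s'|s,k)=1\}$, where $\underline p,\bar p$ denote effective bounds, under the standing assumption (R) given in the context. Suppose that for all $i\in\mathcal{S}$: $$\sum_{s''=0}^{i}\underline p(s''|s,k)\ge\sum_{s''=0}^{i}\underline p(s''|s',k)\quad\text{and}\quad \sum_{s''=i}^{S}\bar p(s''|s,k)\le\sum_{s''=i}^{S}\bar p(s''|s',k)\qquad\text{for all }k\in\mathcal{K},\ s'\ge s,$$ $$\sum_{s''=0}^{i}\underline p(s''|s,k)\ge\sum_{s''=0}^{i}\underline p(s''|s,k')\quad\text{and}\quad \sum_{s''=i}^{S}\bar p(s''|s,k)\le\sum_{s''=i}^{S}\bar p(s''|s,k')\qquad\text{for all }s\in\mathcal{S},\ k'\ge k.$$ Let $k^\ast$ be the threshold and $\zeta_{\rm rm}(k)$ ($k<k^\ast$), $\zeta_{\rm scrap}(k)$ ($k\ge k^\ast$) the control limits of the optimal robust policy, as defined in the context. Then: (a) If $\dfrac{\beta r(0,0)}{1-\beta}-\beta c_{\rm s}\le r(s,k)-r(s,k+1)$ for all $s\in\mathcal{S}$, $k\in\mathcal{K}$, then $\zeta_{\rm rm}(k)$ is non-increasing in $k$ for $k<k^\ast$. (b) $\zeta_{\rm scrap}(k)$ is non-increasing in $k$ for $k\ge k^\ast$.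
   Context: Model. $\mathcal{S}=\{0,1,\dots,S\}$ is the set of conditions of a component (larger is worse), $\mathcal{K}=\{0,1,2,\dots\}$ is the set of cumulative numbers of completed remanufacturing activities, and $\mathcal{A}=\{0,1,2\}$ is the set of actions ($0$: continue operation, $1$: remanufacture, $2$: scrap). The one-period reward of operating is $r(s,k)=g(s,k)-e(s,k)$, where $g$ is the operational gain and $e$ the environmental (carbon) cost; $c_{\rm r}$ is the remanufacturing cost, $c_{\rm s}$ the salvage value, $\beta\in(0,1)$ the discount factor. Under action $0$ the component at $(s,k)$ moves to $(s',k)$ with probability $p(s'|s,k)$; deterioration is irreversible ($p(s'|s,k)=0$ for $s'<s$), and $S$ is absorbing under action $0$. The row $\pmb p(\cdot|s,k)$ is only known to lie in an ambiguity set $\mathcal{U}_{sk}$, and the overall ambiguity set is the product $\bigotimes_{s,k}\mathcal{U}_{sk}$ (rectangularity). The value function $V$ satisfies $$V(s,k)=\max_{a\in\mathcal{A}}w(s,k;a),$$ $$w(s,k;0)=\inf_{\pmb p(\cdot|s,k)\in\mathcal{U}_{sk}}\Big\{r(s,k)+\beta\sum_{s'\in\mathcal{S}}p(s'|s,k)V(s',k)\Big\},\quad w(s,k;1)=-c_{\rm r}+\beta V(0,k+1),\quad w(s,k;2)=c_{\rm s},$$ and is the limit of robust value iteration (iterating the right-hand side starting from the zero function). The optimal robust policy is $a(s,k)\in\arg\max_{a\in\mathcal{A}}w(s,k;a)$. Interval matrix model. Given bounds $0\le\underline p\le\bar p\le1$ with $\mathcal{U}_{sk}$ nonempty and every row in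 $\mathcal{U}_{sk}$ respecting irreversibility and absorption at $S$, the effective upper bounds are $\min\{\bar p(s'|s,k),\,1-\sum_{s''\ne s'}\underline p(s''|s,k)\}$ and the effective lower bounds are $\max\{\underline p(s'|s,k),\,1-\sum_{s''\ne s'}\bar p(s''|s,k)\}$. Throughout, $\bar p$ and $\underline p$ denote these effective bounds. Standing assumption. (R) $g(s,k)$ is non-increasing in $s$ and in $k$; $e(s,k)$ is non-decreasing in $s$ and in $k$; and $\frac{r(S,0)}{1-\beta}<c_{\rm s}$. Control limits. The optimal robust policy has the following form: there are $k^\ast\in\mathcal{K}$ and $s_k\in\mathcal{S}$ ($k\in\mathcal{K}$) such that $a(s,k)=0$ for $s<s_k$; and for $s\ge s_k$, $a(s,k)=1$ if $k<k^\ast$ and $a(s,k)=2$ if $k\ge k^\ast$. One writes $\zeta_{\rm rm}(k)=s_k$ for $k<k^\ast$ and $\zeta_{\rm scrap}(k)=s_k$ for $k\ge k^\ast$.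
   Formalization: Ties in the argmax defining the optimal policy are broken by one fixed priority order on the three actions, the same in every state; with arbitrary selections the claim fails, e.g. if continuing and scrapping tie at one condition for every k. *)

theory Defs
  imports Complex_Main
begin

text \<open>
  Component conditions are the naturals \<open>0, \<dots>, n\<close> and are written first; the cumulative
  number of remanufacturing activities ranges over all of \<open>nat\<close> and is written second.
  Functions of the condition are total on \<open>nat\<close>, and only their values on \<open>{0..n}\<close> matter.
  A transition row at \<open>(s, k)\<close> is a function \<open>p :: nat \<Rightarrow> real\<close> of the successor condition, and
  \<open>pl s k s'\<close>, \<open>pu s k s'\<close> are the given lower and upper bounds on the probability of \<open>s'\<close>.
\<close>

datatype action = Continue | Remanufacture | Scrap

definition reward :: "(nat \<Rightarrow> nat \<Rightarrow> real) \<Rightarrow> (nat \<Rightarrow> nat \<Rightarrow> real) \<Rightarrow> nat \<Rightarrow> nat \<Rightarrow> real" where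
  "reward g e s k = g s k - e s k"

definition eff_lower ::
    "nat \<Rightarrow> (nat \<Rightarrow> nat \<Rightarrow> nat \<Rightarrow> real) \<Rightarrow> (nat \<Rightarrow> nat \<Rightarrow> nat \<Rightarrow> real) \<Rightarrow> nat \<Rightarrow> nat \<Rightarrow> nat \<Rightarrow> real" where
  "eff_lower n pl pu s k s' = max (pl s k s') (1 - (\<Sum>s''\<in>{0..n} - {s'}. pu s k s''))"

definition eff_upper ::
    "nat \<Rightarrow> (nat \<Rightarrow> nat \<Rightarrow> nat \<Rightarrow> real) \<Rightarrow> (nat \<Rightarrow> nat \<Rightarrow> nat \<Rightarrow> real) \<Rightarrow> nat \<Rightarrow> nat \<Rightarrow> nat \<Rightarrow> real" where
  "eff_upper n pl pu s k s' = min (pu s k s') (1 - (\<Sum>s''\<in>{0..n} - {s'}. pl s k s''))"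

definition interval_ambiguity ::
    "nat \<Rightarrow> (nat \<Rightarrow> nat \<Rightarrow> nat \<Rightarrow> real) \<Rightarrow> (nat \<Rightarrow> nat \<Rightarrow> nat \<Rightarrow> real) \<Rightarrow> nat \<Rightarrow> nat \<Rightarrow> (nat \<Rightarrow> real) set" where
  "interval_ambiguity n lo up s k =
     {p. (\<forall>s'\<in>{0..n}. lo s k s' \<le> p s' \<and> p s' \<le> up s k s') \<and> (\<Sum>s'=0..n. p s') = 1}"

text \<open>
  The value \<open>w(s, k; a)\<close> of an action relative to a continuation value \<open>v\<close>.  By rectangularity the
  worst case is taken separately in each row.
\<close>

fun action_value ::
    "nat \<Rightarrow> (nat \<Rightarrow> nat \<Rightarrow> real) \<Rightarrow> real \<Rightarrow> real \<Rightarrow> real \<Rightarrow> (nat \<Rightarrow> nat \<Rightarrow> (nat \<Rightarrow> real) set) \<Rightarrow>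
     (nat \<Rightarrow> nat \<Rightarrow> real) \<Rightarrow> nat \<Rightarrow> nat \<Rightarrow> action \<Rightarrow> real" where
  "action_value n r cr cs \<beta> U v s k Continue =
     (INF p\<in>U s k. r s k + \<beta> * (\<Sum>s'=0..n. p s' * v s' k))"
| "action_value n r cr cs \<beta> U v s k Remanufacture = - cr + \<beta> * v 0 (k + 1)"
| "action_value n r cr cs \<beta> U v s k Scrap = cs"

definition bellman ::
    "nat \<Rightarrow> (nat \<Rightarrow> nat \<Rightarrow> real) \<Rightarrow> real \<Rightarrow> real \<Rightarrow> real \<Rightarrow> (nat \<Rightarrow> nat \<Rightarrow> (nat \<Rightarrow> real) set) \<Rightarrow>
     (nat \<Rightarrow> nat \<Rightarrow> real) \<Rightarrow> nat \<Rightarrow> nat \<Rightarrow> real" where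
  "bellman n r cr cs \<beta> U v =
     (\<lambda>s k. MAX a\<in>{Continue, Remanufacture, Scrap}. action_value n r cr cs \<beta> U v s k a)"

definition robust_value ::
    "nat \<Rightarrow> (nat \<Rightarrow> nat \<Rightarrow> real) \<Rightarrow> real \<Rightarrow> real \<Rightarrow> real \<Rightarrow> (nat \<Rightarrow> nat \<Rightarrow> (nat \<Rightarrow> real) set) \<Rightarrow>
     nat \<Rightarrow> nat \<Rightarrow> real" where
  "robust_value n r cr cs \<beta> U s k =
     lim (\<lambda>m. (bellman n r cr cs \<beta> U ^^ m) (\<lambda>_ _. 0) s k)"

text \<open>
  The policy \<open>a\<close> picks a maximiser of \<open>w s k\<close> in every state, ties being broken by the priority
  \<open>prio\<close>, the same in all states.  Without a uniform rule control limits need not be monotone: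
  where, say, continuing and scrapping are equally good at one condition \<open>s\<close> for every \<open>k\<close>, a
  selection from the maximisers may alternate between the two as \<open>k\<close> grows.
\<close>

definition optimal_policy ::
    "nat \<Rightarrow> (nat \<Rightarrow> nat \<Rightarrow> action \<Rightarrow> real) \<Rightarrow> (action \<Rightarrow> nat) \<Rightarrow> (nat \<Rightarrow> nat \<Rightarrow> action) \<Rightarrow> bool" where
  "optimal_policy n w prio a \<longleftrightarrow>
     (\<forall>s\<in>{0..n}. \<forall>k. is_arg_max (w s k) (\<lambda>_. True) (a s k) \<and>
        (\<forall>b. is_arg_max (w s k) (\<lambda>_. True) b \<longrightarrow> prio b \<le> prio (a s k)))"

text \<open>
  \<open>\<zeta> k\<close> is the control limit for remanufacturing when \<open>k < kstar\<close> and the one for scrapping when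
  \<open>k \<ge> kstar\<close>.
\<close>

definition control_limits ::
    "nat \<Rightarrow> (nat \<Rightarrow> nat \<Rightarrow> action) \<Rightarrow> nat \<Rightarrow> (nat \<Rightarrow> nat) \<Rightarrow> bool" where
  "control_limits n a kstar \<zeta> \<longleftrightarrow>
     (\<forall>k. \<zeta> k \<in> {0..n} \<and>
        (\<forall>s\<in>{0..n}. a s k =
           (if s < \<zeta> k then Continue else if k < kstar then Remanufacture else Scrap)))"

end

(*
  One row in each ambiguity set minimises the expectation of every non-increasing function
  simultaneously: its distribution function is the smallest one that the bounds admit.  The
  hypotheses on partial sums say that this worst row increases stochastically in s and in k, so
  value iteration stays among the functions that are non-increasing in s and k, and the value
  function is the fixed point of an ordinary Bellman operator.  Hence the value of continuing
  decreases in k while that of scrapping is constant, which gives (b).  For (a), values lie between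
  c_s and max (r(0,0) / (1 - beta)) c_s, so the hypothesis of (a) makes continuing lose at least as
  much as remanufacturing when k grows.  The bound on the values uses -c_r <= (1 - beta) c_s, which
  holds because scrapping is optimal in the state (S, kstar).
*)
theory Submission
  imports Defs
begin

section \<open>The worst row\<close>

text \<open>Summation by parts. Replacing \<open>f m\<close> by the smaller \<open>f (Suc m)\<close>
  as a factor of a nonpositive partial sum can only raise the bound; keeping
  \<open>f m * sum q {..m}\<close> on the right, rather than 0, lets the induction close.\<close>

lemma sum_mult_antimono_le:
  fixes q f :: "nat \<Rightarrow> real"
  assumes "antimono_on {0..n} f" "\<And>i. i \<le> n \<Longrightarrow> sum q {..i} \<le> 0" "m \<le> n"
  shows "(\<Sum>i\<le>m. q i * f i) \<le> f m * sum q {..m}"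
  using assms(3)
proof (induction m)
  case 0
  then show ?case by simp
next
  case (Suc m)
  have "f (Suc m) \<le> f m"
    using Suc.prems monotone_onD[OF assms(1), of m "Suc m"] by simp
  then have "f m * sum q {..m} \<le> f (Suc m) * sum q {..m}"
    using assms(2)[of m] Suc.prems by (intro mult_right_mono_neg) auto
  then show ?case
    using Suc by (simp add: algebra_simps)
qed

text \<open>First-order stochastic dominance: \<open>q - p\<close> has nonpositive partial sums and
  total 0, so the bound from summation by parts vanishes at \<open>n\<close>.\<close>

lemma expectation_antimono_le:
  fixes p q f :: "nat \<Rightarrow> real"
  assumes "antimono_on {0..n} f" "\<And>i. i \<le> n \<Longrightarrow> sum q {..i} \<le> sum p {..i}"
    and "sum q {..n} = sum p {..n}"
  shows "(\<Sum>i=0..n. q i * f i) \<le> (\<Sum>i=0..n. p i * f i)"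
  using sum_mult_antimono_le[OF assms(1), of "\<lambda>i. q i - p i" n] assms(2,3)
  by (simp add: sum_subtractf left_diff_distrib atLeast0AtMost)

text \<open>Mass strictly below \<open>i\<close>, hence shifted by one against the usual
  distribution function. The terms of the maximum are the two lower estimates of that mass: the
  lower bounds below \<open>i\<close>, and what the upper bounds from \<open>i\<close> on leave
  over.\<close>

definition worst_cdf :: "nat \<Rightarrow> (nat \<Rightarrow> real) \<Rightarrow> (nat \<Rightarrow> real) \<Rightarrow> nat \<Rightarrow> real" where
  "worst_cdf n l u i = max (sum l {..<i}) (1 - sum u {i..n})"

definition worst_row :: "nat \<Rightarrow> (nat \<Rightarrow> real) \<Rightarrow> (nat \<Rightarrow> real) \<Rightarrow> nat \<Rightarrow> real" where
  "worst_row n l u i = worst_cdf n l u (Suc i) - worst_cdf n l u i"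

text \<open>From \<open>i\<close> to \<open>Suc i\<close> the two terms of the maximum grow by
  \<open>l i\<close> and by \<open>u i\<close>, so the maximum grows by an amount between
  them.\<close>

lemma worst_row_bounds:
  assumes "i \<le> n" "l i \<le> u i"
  shows "l i \<le> worst_row n l u i" "worst_row n l u i \<le> u i"
proof -
  have "sum u {i..n} = u i + sum u {Suc i..n}"
    using assms(1) by (rule sum.atLeast_Suc_atMost)
  then show "l i \<le> worst_row n l u i" "worst_row n l u i \<le> u i"
    using assms(2) by (auto simp: worst_row_def worst_cdf_def)
qed

text \<open>The sum telescopes, and it starts from 0 because the upper bounds have total at least
  1.\<close>

lemma sum_worst_row:
  assumes "1 \<le> sum u {0..n}"
  shows "sum (worst_row n l u) {..m} = worst_cdf n l u (Suc m)"
proof -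
  have "sum (worst_row n l u) {..m} = worst_cdf n l u (Suc m) - worst_cdf n l u 0"
    unfolding worst_row_def lessThan_Suc_atMost[symmetric] by (rule sum_lessThan_telescope)
  then show ?thesis
    using assms by (simp add: worst_cdf_def)
qed

lemma worst_cdf_top:
  assumes "sum l {0..n} \<le> 1"
  shows "worst_cdf n l u (Suc n) = 1"
  using assms by (simp add: worst_cdf_def lessThan_Suc_atMost atLeast0AtMost)

text \<open>Any feasible row puts at least the lower bounds on \<open>{..m}\<close> and at most the
  upper bounds on the complement.\<close>

lemma worst_cdf_le:
  assumes "\<And>i. i \<le> n \<Longrightarrow> l i \<le> p i \<and> p i \<le> u i" "sum p {..n} = 1" "m \<le> n"
  shows "worst_cdf n l u (Suc m) \<le> sum p {..m}"
proof -
  have "{..n} = {..m} \<union> {Suc m..n}"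
    using assms(3) by auto
  then have "1 = sum p {..m} + sum p {Suc m..n}"
    by (metis assms(2) sum.union_disjoint finite_atMost finite_atLeastAtMost
        ivl_disj_int_one(5) ivl_disj_int(7) disjoint_iff atMost_iff atLeastAtMost_iff not_less_eq_eq)
  moreover have "sum l {..m} \<le> sum p {..m}" "sum p {Suc m..n} \<le> sum u {Suc m..n}"
    using assms(1,3) by (auto intro!: sum_mono)
  ultimately show ?thesis
    by (simp add: worst_cdf_def lessThan_Suc_atMost)
qed

lemma worst_cdf_mono:
  assumes "\<And>i. i \<le> n \<Longrightarrow> sum l' {0..i} \<le> sum l {0..i} \<and> sum u {i..n} \<le> sum u' {i..n}"
    and "m \<le> n"
  shows "worst_cdf n l' u' (Suc m) \<le> worst_cdf n l u (Suc m)"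
proof -
  \<comment> \<open>For \<open>m = n\<close> both tails are empty.\<close>
  have "sum u {Suc m..n} \<le> sum u' {Suc m..n}"
    using assms(1)[of "Suc m"] by (cases "Suc m \<le> n") auto
  then show ?thesis
    using assms(1)[OF assms(2)]
    by (auto simp: worst_cdf_def lessThan_Suc_atMost atLeast0AtMost)
qed

section \<open>Value iteration\<close>

definition decreasing :: "nat \<Rightarrow> (nat \<Rightarrow> nat \<Rightarrow> real) \<Rightarrow> bool" where
  "decreasing n v \<longleftrightarrow> (\<forall>s s' k k'. s \<le> s' \<longrightarrow> s' \<le> n \<longrightarrow> k \<le> k' \<longrightarrow> v s' k' \<le> v s k)"

lemma decreasingD: "decreasing n v \<Longrightarrow> s \<le> s' \<Longrightarrow> s' \<le> n \<Longrightarrow> k \<le> k' \<Longrightarrow> v s' k' \<le> v s k"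
  by (simp add: decreasing_def)

lemma decreasing_antimono_on: "decreasing n v \<Longrightarrow> antimono_on {0..n} (\<lambda>s. v s k)"
  by (auto simp: decreasing_def intro!: monotone_onI)

lemma expectation_mono:
  fixes p f f' :: "nat \<Rightarrow> real"
  assumes "\<And>i. i \<le> n \<Longrightarrow> 0 \<le> p i" "\<And>i. i \<le> n \<Longrightarrow> f i \<le> f' i"
  shows "(\<Sum>i=0..n. p i * f i) \<le> (\<Sum>i=0..n. p i * f' i)"
  using assms by (auto intro!: sum_mono mult_left_mono)

text \<open>Keeps only what value iteration uses of the ambiguity sets: a feasible row
  \<open>P s k\<close> that is worst for every non-increasing function at once, and that increases
  stochastically in \<open>s\<close> and \<open>k\<close>.\<close>

locale worst_case_model =
  fixes n :: nat and r :: "nat \<Rightarrow> nat \<Rightarrow> real" and cr cs \<beta> :: real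
    and U :: "nat \<Rightarrow> nat \<Rightarrow> (nat \<Rightarrow> real) set" and P :: "nat \<Rightarrow> nat \<Rightarrow> nat \<Rightarrow> real"
  assumes beta: "0 < \<beta>" "\<beta> < 1"
    and r_decreasing: "decreasing n r"
    and P_nonneg: "\<And>s k i. s \<le> n \<Longrightarrow> i \<le> n \<Longrightarrow> 0 \<le> P s k i"
    and P_sum: "\<And>s k. s \<le> n \<Longrightarrow> sum (P s k) {0..n} = 1"
    and P_in: "\<And>s k. s \<le> n \<Longrightarrow> P s k \<in> U s k"
    and P_worst: "\<And>s k p f. s \<le> n \<Longrightarrow> p \<in> U s k \<Longrightarrow> antimono_on {0..n} f \<Longrightarrow>
          (\<Sum>i=0..n. P s k i * f i) \<le> (\<Sum>i=0..n. p i * f i)"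
    and P_mono: "\<And>s s' k k' f. s \<le> s' \<Longrightarrow> s' \<le> n \<Longrightarrow> k \<le> k' \<Longrightarrow> antimono_on {0..n} f \<Longrightarrow>
          (\<Sum>i=0..n. P s' k' i * f i) \<le> (\<Sum>i=0..n. P s k i * f i)"
begin

section \<open>The Bellman operator on decreasing functions\<close>

abbreviation W :: "(nat \<Rightarrow> nat \<Rightarrow> real) \<Rightarrow> nat \<Rightarrow> nat \<Rightarrow> action \<Rightarrow> real" where
  "W \<equiv> action_value n r cr cs \<beta> U"

abbreviation B :: "(nat \<Rightarrow> nat \<Rightarrow> real) \<Rightarrow> nat \<Rightarrow> nat \<Rightarrow> real" where
  "B \<equiv> bellman n r cr cs \<beta> U"

abbreviation V :: "nat \<Rightarrow> nat \<Rightarrow> real" where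
  "V \<equiv> robust_value n r cr cs \<beta> U"

abbreviation iterate :: "nat \<Rightarrow> nat \<Rightarrow> nat \<Rightarrow> real" where
  "iterate m \<equiv> (B ^^ m) (\<lambda>_ _. 0)"

text \<open>The infimum is attained at \<open>P s k\<close>, so on decreasing functions the robust
  operator is an ordinary one with fixed transition rows.\<close>

lemma continue_value:
  assumes "decreasing n v" "s \<le> n"
  shows "W v s k Continue = r s k + \<beta> * (\<Sum>i=0..n. P s k i * v i k)"
proof -
  have "Inf ((\<lambda>p. r s k + \<beta> * (\<Sum>i=0..n. p i * v i k)) ` U s k)
      = r s k + \<beta> * (\<Sum>i=0..n. P s k i * v i k)"
    using P_in[OF assms(2)] P_worst[OF assms(2) _ decreasing_antimono_on[OF assms(1)]] beta
    by (intro cInf_eq_minimum) auto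
  then show ?thesis by simp
qed

lemma bellman_eq: "B v s k = max (W v s k Continue) (max (W v s k Remanufacture) cs)"
  by (simp add: bellman_def)

lemma continue_value_mono:
  assumes "decreasing n v" "s \<le> s'" "s' \<le> n" "k \<le> k'"
  shows "W v s' k' Continue \<le> W v s k Continue"
proof -
  \<comment> \<open>First the row changes while the values stay at \<open>k'\<close>; then the
    values change under the row of \<open>(s, k)\<close>.\<close>
  have "(\<Sum>i=0..n. P s' k' i * v i k') \<le> (\<Sum>i=0..n. P s k i * v i k')"
    using assms by (intro P_mono decreasing_antimono_on)
  also have "\<dots> \<le> (\<Sum>i=0..n. P s k i * v i k)"
    using assms by (intro expectation_mono P_nonneg decreasingD[OF assms(1)]) auto
  finally have "\<beta> * (\<Sum>i=0..n. P s' k' i * v i k') \<le> \<beta> * (\<Sum>i=0..n. P s k i * v i k)"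
    using beta by simp
  moreover have "r s' k' \<le> r s k"
    using assms by (intro decreasingD[OF r_decreasing])
  ultimately show ?thesis
    using assms by (simp add: continue_value del: action_value.simps(1))
qed

lemma bellman_decreasing: "decreasing n v \<Longrightarrow> decreasing n (B v)"
  unfolding decreasing_def[of n "B v"]
proof (intro allI impI)
  fix s s' k k' assume v: "decreasing n v" and "s \<le> s'" "s' \<le> n" "k \<le> (k'::nat)"
  then have "W v s' k' Continue \<le> W v s k Continue"
    by (rule continue_value_mono)
  moreover have "W v s' k' Remanufacture \<le> W v s k Remanufacture"
    using beta decreasingD[OF v, of 0 0 "k + 1" "k' + 1"] \<open>k \<le> k'\<close> by simp
  ultimately show "B v s' k' \<le> B v s k"
    unfolding bellman_eq by linarith
qed

lemma iterate_decreasing: "decreasing n (iterate m)"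
proof (induction m)
  case 0
  show ?case by (simp add: decreasing_def)
qed (simp add: bellman_decreasing)

text \<open>A constant shift \<open>d\<close> passes through the expectation because rows have total
  mass 1, and \<open>\<beta>\<close> then discounts it. Both functions are decreasing so that the
  same row \<open>P s k\<close> is worst for each.\<close>

lemma bellman_contraction_le:
  assumes "decreasing n v" "decreasing n v'" "\<And>s k. s \<le> n \<Longrightarrow> v s k \<le> v' s k + d" "s \<le> n" "0 \<le> d"
  shows "B v s k \<le> B v' s k + \<beta> * d"
proof -
  have "(\<Sum>i=0..n. P s k i * v i k) \<le> (\<Sum>i=0..n. P s k i * (v' i k + d))"
    using assms by (intro expectation_mono P_nonneg)
  also have "\<dots> = (\<Sum>i=0..n. P s k i * v' i k) + d"
    using P_sum[OF assms(4)] by (simp add: distrib_left sum.distrib flip: sum_distrib_right)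
  finally have "\<beta> * (\<Sum>i=0..n. P s k i * v i k) \<le> \<beta> * (\<Sum>i=0..n. P s k i * v' i k) + \<beta> * d"
    using beta by (simp flip: distrib_left)
  then have "W v s k Continue \<le> W v' s k Continue + \<beta> * d"
    using assms by (simp add: continue_value del: action_value.simps(1))
  moreover have "W v s k Remanufacture \<le> W v' s k Remanufacture + \<beta> * d"
    using assms(3)[of 0 "k + 1"] beta by (simp flip: distrib_left)
  moreover have "0 \<le> \<beta> * d"
    using assms(5) beta by simp
  ultimately show ?thesis
    unfolding bellman_eq by linarith
qed

lemma bellman_contraction:
  assumes "decreasing n v" "decreasing n v'" "\<And>s k. s \<le> n \<Longrightarrow> \<bar>v s k - v' s k\<bar> \<le> d" "s \<le> n"
  shows "\<bar>B v s k - B v' s k\<bar> \<le> \<beta> * d"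
proof -
  have "0 \<le> d"
    using assms(3)[OF assms(4)] by (meson abs_ge_zero order_trans)
  moreover have "v s k \<le> v' s k + d" "v' s k \<le> v s k + d" if "s \<le> n" for s k
    using assms(3)[OF that, of k] by linarith+
  ultimately have "B v s k \<le> B v' s k + \<beta> * d" "B v' s k \<le> B v s k + \<beta> * d"
    using assms by (auto intro!: bellman_contraction_le)
  then show ?thesis by linarith
qed

text \<open>The rewards need not be bounded below, but scrapping bounds the values below by \<open>cs\<close>.\<close>

lemma iterate_difference:
  "s \<le> n \<Longrightarrow> \<bar>iterate (Suc m) s k - iterate m s k\<bar> \<le> \<beta> ^ m * (\<bar>r 0 0\<bar> + \<bar>cr\<bar> + \<bar>cs\<bar>)"
proof (induction m arbitrary: s k)
  case 0
  have "decreasing n (\<lambda>_ _. 0)"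
    by (simp add: decreasing_def)
  then have "W (\<lambda>_ _. 0) s k Continue = r s k"
    using 0 by (simp add: continue_value del: action_value.simps(1))
  moreover have "r s k \<le> r 0 0"
    using 0 by (intro decreasingD[OF r_decreasing]) auto
  ultimately show ?case
    by (simp add: bellman_eq del: action_value.simps(1))
next
  case (Suc m)
  then show ?case
    using bellman_contraction[OF iterate_decreasing iterate_decreasing Suc.IH Suc.prems, where k = k]
    by (simp add: mult.assoc)
qed

text \<open>Consecutive differences are dominated by a geometric series, and their partial sums
  telescope to the iterates.\<close>

lemma iterate_tendsto:
  assumes "s \<le> n"
  shows "(\<lambda>m. iterate m s k) \<longlonglongrightarrow> V s k"
proof -
  have "summable (\<lambda>m. iterate (Suc m) s k - iterate m s k)"
  proof (rule summable_comparison_test')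
    show "summable (\<lambda>m. \<beta> ^ m * (\<bar>r 0 0\<bar> + \<bar>cr\<bar> + \<bar>cs\<bar>))"
      using beta by (intro summable_mult2 summable_geometric) simp
  qed (use iterate_difference[OF assms] in simp)
  then have "convergent (\<lambda>m. iterate m s k)"
    by (simp add: summable_iff_convergent sum_lessThan_telescope[where f = "\<lambda>m. iterate m s k"]
        del: funpow.simps)
  then show ?thesis
    by (simp add: robust_value_def convergent_LIMSEQ_iff)
qed

section \<open>Monotonicity, fixed point and bounds of the value function\<close>

lemma value_decreasing: "decreasing n V"
  unfolding decreasing_def
proof (intro allI impI)
  fix s s' k k' assume *: "s \<le> s'" "s' \<le> n" "k \<le> (k'::nat)"
  show "V s' k' \<le> V s k"
  proof (rule LIMSEQ_le)
    show "(\<lambda>m. iterate m s' k') \<longlonglongrightarrow> V s' k'" "(\<lambda>m. iterate m s k) \<longlonglongrightarrow> V s k"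
      using * by (auto intro: iterate_tendsto)
  qed (use * decreasingD[OF iterate_decreasing] in blast)
qed

text \<open>With the infimum replaced by the worst row, one step of the iteration is a continuous
  expression in finitely many values, so the limit passes through it.\<close>

lemma value_fixed_point:
  assumes "s \<le> n"
  shows "V s k = B V s k"
proof (rule LIMSEQ_unique)
  show "(\<lambda>m. iterate (Suc m) s k) \<longlonglongrightarrow> V s k"
    using iterate_tendsto[OF assms] by (rule LIMSEQ_Suc)
  have "(\<lambda>m. max (r s k + \<beta> * (\<Sum>i=0..n. P s k i * iterate m i k))
            (max (- cr + \<beta> * iterate m 0 (k + 1)) cs))
      \<longlonglongrightarrow> max (r s k + \<beta> * (\<Sum>i=0..n. P s k i * V i k)) (max (- cr + \<beta> * V 0 (k + 1)) cs)"
    by (intro tendsto_intros tendsto_max iterate_tendsto) auto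
  then show "(\<lambda>m. iterate (Suc m) s k) \<longlonglongrightarrow> B V s k"
    using assms iterate_decreasing value_decreasing
    by (simp add: bellman_eq continue_value del: action_value.simps(1))
qed

lemma scrap_le_value:
  assumes "s \<le> n"
  shows "cs \<le> V s k"
  by (simp add: value_fixed_point[OF assms] bellman_eq del: action_value.simps(1))

text \<open>The value is largest at \<open>(0, 0)\<close>. There every continuation value is at most
  \<open>V 0 0\<close>, and solving the resulting inequality gives one bound per action; the
  hypothesis on \<open>cr\<close> brings the bound for remanufacturing,
  \<open>- cr / (1 - \<beta>)\<close>, below \<open>cs\<close>.\<close>

lemma value_le:
  assumes "- cr \<le> (1 - \<beta>) * cs" "s \<le> n"
  shows "V s k \<le> max (r 0 0 / (1 - \<beta>)) cs"
proof -
  have "(\<Sum>i=0..n. P 0 0 i * V i 0) \<le> (\<Sum>i=0..n. P 0 0 i * V 0 0)"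
    by (intro expectation_mono P_nonneg decreasingD[OF value_decreasing]) auto
  also have "\<dots> = V 0 0"
    using P_sum[of 0 0] by (simp flip: sum_distrib_right)
  finally have "W V 0 0 Continue \<le> r 0 0 + \<beta> * V 0 0"
    using beta value_decreasing by (simp add: continue_value del: action_value.simps(1))
  moreover have "W V 0 0 Remanufacture \<le> - cr + \<beta> * V 0 0"
    using beta decreasingD[OF value_decreasing, of 0 0 0 1] by simp
  ultimately have "V 0 0 \<le> max (r 0 0 + \<beta> * V 0 0) (max (- cr + \<beta> * V 0 0) cs)"
    using value_fixed_point[of 0 0] unfolding bellman_eq by linarith
  then have "(1 - \<beta>) * V 0 0 \<le> r 0 0 \<or> (1 - \<beta>) * V 0 0 \<le> - cr \<or> V 0 0 \<le> cs"
    by (auto simp: algebra_simps max_def split: if_splits)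
  moreover have "V 0 0 \<le> cs" if "(1 - \<beta>) * V 0 0 \<le> - cr"
    using order_trans[OF that assms(1)] beta by simp
  ultimately have "V 0 0 \<le> max (r 0 0 / (1 - \<beta>)) cs"
    using beta by (auto simp: field_simps le_max_iff_disj)
  moreover have "V s k \<le> V 0 0"
    using assms(2) by (intro decreasingD[OF value_decreasing]) auto
  ultimately show ?thesis by linarith
qed

text \<open>Between \<open>k\<close> and \<open>k'\<close> remanufacturing loses at most
  \<open>\<beta>\<close> times the range of the values, whatever the distance, while continuing
  loses at least the reward drop of the first step. Thus a hypothesis on single steps covers all
  \<open>k < k'\<close>.\<close>

lemma remanufacture_advantage_mono:
  assumes cr: "- cr \<le> (1 - \<beta>) * cs"
    and drop: "\<And>k. \<beta> * r 0 0 / (1 - \<beta>) - \<beta> * cs \<le> r s k - r s (k + 1)"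
    and "s \<le> n" "k < k'"
  shows "W V s k Remanufacture - W V s k Continue \<le> W V s k' Remanufacture - W V s k' Continue"
proof -
  have rem: "W V s k Remanufacture - W V s k' Remanufacture = \<beta> * (V 0 (k + 1) - V 0 (k' + 1))"
    by (simp add: algebra_simps)
  have bounds: "V 0 (k + 1) \<le> max (r 0 0 / (1 - \<beta>)) cs" "cs \<le> V 0 (k' + 1)"
    using value_le[OF cr] scrap_le_value by auto
  show ?thesis
  proof (cases "cs \<le> r 0 0 / (1 - \<beta>)")
    case True
    have "(\<Sum>i=0..n. P s k' i * V i k') \<le> (\<Sum>i=0..n. P s k' i * V i k)"
      using assms by (intro expectation_mono P_nonneg decreasingD[OF value_decreasing]) auto
    also have "\<dots> \<le> (\<Sum>i=0..n. P s k i * V i k)"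
      using assms by (intro P_mono decreasing_antimono_on[OF value_decreasing]) auto
    finally have "\<beta> * (\<Sum>i=0..n. P s k' i * V i k') \<le> \<beta> * (\<Sum>i=0..n. P s k i * V i k)"
      using beta by simp
    then have "r s k - r s k' \<le> W V s k Continue - W V s k' Continue"
      using assms(3) value_decreasing by (simp add: continue_value del: action_value.simps(1))
    moreover have "r s k' \<le> r s (k + 1)"
      using assms by (intro decreasingD[OF r_decreasing]) auto
    moreover have "\<beta> * (V 0 (k + 1) - V 0 (k' + 1)) \<le> \<beta> * (r 0 0 / (1 - \<beta>) - cs)"
      using bounds True beta by (intro mult_left_mono) auto
    ultimately show ?thesis
      using rem drop[of k] by (simp add: right_diff_distrib del: action_value.simps)
  next
    case False
    \<comment> \<open>Here the upper bound on the values is \<open>cs\<close> itself, so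
      remanufacturing loses nothing.\<close>
    then have "\<beta> * (V 0 (k + 1) - V 0 (k' + 1)) \<le> 0"
      using bounds beta by (intro mult_nonneg_nonpos) auto
    moreover have "W V s k' Continue \<le> W V s k Continue"
      using assms by (intro continue_value_mono value_decreasing) auto
    ultimately show ?thesis
      using rem by linarith
  qed
qed

end

section \<open>Control limits\<close>

lemma optimal_policy_ge:
  "optimal_policy n w prio a \<Longrightarrow> s \<in> {0..n} \<Longrightarrow> w s k b \<le> w s k (a s k)"
  by (auto simp: optimal_policy_def is_arg_max_linorder)

text \<open>A switch back to \<open>Continue\<close> would force ties at both \<open>k\<close> and
  \<open>k'\<close>, resolved in opposite ways; a uniform injective priority excludes this.\<close>

lemma preferred_action_persists:
  assumes "optimal_policy n w prio a" "inj prio" "s \<in> {0..n}"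
    and "a s k = b" "a s k' \<in> {Continue, b}"
    and "w s k b - w s k Continue \<le> w s k' b - w s k' Continue"
  shows "a s k' = b"
proof (rule ccontr)
  assume "a s k' \<noteq> b"
  then have c: "a s k' = Continue" "b \<noteq> Continue"
    using assms(5) by auto
  note opt = optimal_policy_ge[OF assms(1,3)]
  have prio: "prio x \<le> prio (a s j)" if "w s j x = w s j (a s j)" for j x
    using assms(1,3) opt that by (auto simp: optimal_policy_def is_arg_max_linorder)
  \<comment> \<open>Optimality makes the advantage of \<open>b\<close> nonnegative at
    \<open>k\<close> and nonpositive at \<open>k'\<close>; since it does not fall, it is 0 at
    both.\<close>
  have "w s k Continue = w s k b" "w s k' b = w s k' Continue"
    using opt[of k Continue] opt[of k' b] assms(4,6) c(1) by auto
  then have "prio Continue \<le> prio b" "prio b \<le> prio Continue"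
    using prio[of k Continue] prio[of k' b] assms(4) c(1) by auto
  then have "prio b = prio Continue"
    by simp
  then show False
    using injD[OF assms(2)] c(2) by blast
qed

text \<open>At the condition \<open>\<zeta> k\<close> the action \<open>b\<close> is chosen for
  \<open>k\<close>, hence also for \<open>k'\<close>, so this condition is not below
  \<open>\<zeta> k'\<close>. Both indices lie on the same side of \<open>kstar\<close>, which makes
  \<open>b\<close> the same action for each.\<close>

lemma control_limits_antimono:
  assumes "control_limits n a kstar \<zeta>" "optimal_policy n w prio a" "inj prio"
    and "k < kstar \<longleftrightarrow> k' < kstar"
    and "b = (if k < kstar then Remanufacture else Scrap)"
    and "\<And>s. s \<le> n \<Longrightarrow> w s k b - w s k Continue \<le> w s k' b - w s k' Continue"
  shows "\<zeta> k' \<le> \<zeta> k"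
proof -
  have \<zeta>: "\<zeta> k \<in> {0..n}"
    using assms(1) by (simp add: control_limits_def)
  have act: "a (\<zeta> k) j = (if \<zeta> k < \<zeta> j then Continue else if j < kstar then Remanufacture else Scrap)" for j
    using assms(1) \<zeta> by (simp add: control_limits_def)
  have "a (\<zeta> k) k' = b"
  proof (rule preferred_action_persists[OF assms(2,3) \<zeta>])
    show "a (\<zeta> k) k = b" "a (\<zeta> k) k' \<in> {Continue, b}"
      using assms(4,5) by (auto simp: act)
  qed (use assms(6) \<zeta> in auto)
  moreover have "b \<noteq> Continue"
    using assms(5) by simp
  ultimately show ?thesis
    by (metis act not_le)
qed

theorem theorem4:
  fixes n :: nat
    and g e r :: "nat \<Rightarrow> nat \<Rightarrow> real"
    and cr cs \<beta> :: real
    and pl pu lo up :: "nat \<Rightarrow> nat \<Rightarrow> nat \<Rightarrow> real"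
    and U :: "nat \<Rightarrow> nat \<Rightarrow> (nat \<Rightarrow> real) set"
    and V :: "nat \<Rightarrow> nat \<Rightarrow> real"
    and w :: "nat \<Rightarrow> nat \<Rightarrow> action \<Rightarrow> real"
    and prio :: "action \<Rightarrow> nat"
    and a :: "nat \<Rightarrow> nat \<Rightarrow> action"
    and kstar :: nat
    and \<zeta> :: "nat \<Rightarrow> nat"
  assumes beta: "0 < \<beta>" "\<beta> < 1"
    and r: "r = reward g e"
    and bounds: "\<And>s k s'. \<lbrakk>s \<in> {0..n}; s' \<in> {0..n}\<rbrakk> \<Longrightarrow>
          0 \<le> pl s k s' \<and> pl s k s' \<le> pu s k s' \<and> pu s k s' \<le> 1"
    and lo: "lo = eff_lower n pl pu"
    and up: "up = eff_upper n pl pu"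
    and U: "U = interval_ambiguity n lo up"
    and U_nonempty: "\<And>s k. s \<in> {0..n} \<Longrightarrow> U s k \<noteq> {}"
    and irreversible: "\<And>s k p s'. \<lbrakk>s \<in> {0..n}; p \<in> U s k; s' < s\<rbrakk> \<Longrightarrow> p s' = 0"
    and absorbing: "\<And>k p. p \<in> U n k \<Longrightarrow> p n = 1"
    and g_mono_s: "\<And>k. antimono_on {0..n} (\<lambda>s. g s k)"
    and g_mono_k: "\<And>s. s \<in> {0..n} \<Longrightarrow> antimono (g s)"
    and e_mono_s: "\<And>k. mono_on {0..n} (\<lambda>s. e s k)"
    and e_mono_k: "\<And>s. s \<in> {0..n} \<Longrightarrow> mono (e s)"
    and scrap_worst: "r n 0 / (1 - \<beta>) < cs"
    and dom_s: "\<And>i s s' k. \<lbrakk>i \<in> {0..n}; s \<in> {0..n}; s' \<in> {0..n}; s \<le> s'\<rbrakk> \<Longrightarrow>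
          (\<Sum>s''=0..i. lo s k s'') \<ge> (\<Sum>s''=0..i. lo s' k s'') \<and>
          (\<Sum>s''=i..n. up s k s'') \<le> (\<Sum>s''=i..n. up s' k s'')"
    and dom_k: "\<And>i s k k'. \<lbrakk>i \<in> {0..n}; s \<in> {0..n}; k \<le> k'\<rbrakk> \<Longrightarrow>
          (\<Sum>s''=0..i. lo s k s'') \<ge> (\<Sum>s''=0..i. lo s k' s'') \<and>
          (\<Sum>s''=i..n. up s k s'') \<le> (\<Sum>s''=i..n. up s k' s'')"
    and V: "V = robust_value n r cr cs \<beta> U"
    and w: "w = action_value n r cr cs \<beta> U V"
    and tie_breaking: "inj prio"
    and policy: "optimal_policy n w prio a"
    and limits: "control_limits n a kstar \<zeta>"
  shows "((\<forall>s\<in>{0..n}. \<forall>k. \<beta> * r 0 0 / (1 - \<beta>) - \<beta> * cs \<le> r s k - r s (k + 1)) \<longrightarrow>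
            antimono_on {..<kstar} \<zeta>) \<and>
         antimono_on {kstar..} \<zeta>"
proof -
  let ?P = "\<lambda>s k. worst_row n (lo s k) (up s k)"
  have row: "(\<forall>i\<le>n. lo s k i \<le> p i \<and> p i \<le> up s k i) \<and> sum p {..n} = 1"
    if "p \<in> U s k" for p s k
    using that by (auto simp: U interval_ambiguity_def atLeast0AtMost)
  have lo_nonneg: "0 \<le> lo s k i" if "s \<le> n" "i \<le> n" for s k i
    using bounds[of s i k] that by (auto simp: lo eff_lower_def le_max_iff_disj)
  \<comment> \<open>Any member of the nonempty set \<open>U s k\<close> lies between the effective
    bounds; the estimates of their totals come from such a row too.\<close>
  have lo_le_up: "lo s k i \<le> up s k i" if "s \<le> n" "i \<le> n" for s k i
    using U_nonempty[of s k] row[of _ s k] that by fastforce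
  have sums: "sum (lo s k) {0..n} \<le> 1" "1 \<le> sum (up s k) {0..n}" if s: "s \<le> n" for s k
  proof -
    obtain p where "p \<in> U s k"
      using U_nonempty[of s k] s by auto
    note p = row[OF this]
    have "sum (lo s k) {..n} \<le> sum p {..n}" "sum p {..n} \<le> sum (up s k) {..n}"
      using conjunct1[OF p] by (auto intro!: sum_mono)
    with p show "sum (lo s k) {0..n} \<le> 1" "1 \<le> sum (up s k) {0..n}"
      by (simp_all add: atLeast0AtMost)
  qed
  have cdf: "sum (?P s k) {..m} = worst_cdf n (lo s k) (up s k) (Suc m)" if "s \<le> n" for s k m
    using sums(2)[OF that] by (rule sum_worst_row)
  have total: "sum (?P s k) {..n} = 1" if "s \<le> n" for s k
    unfolding cdf[OF that] using sums(1)[OF that] by (rule worst_cdf_top)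

  interpret worst_case_model n r cr cs \<beta> U ?P
  proof
    show "decreasing n r"
      unfolding decreasing_def
    proof (intro allI impI)
      fix s s' k k' assume *: "s \<le> s'" "s' \<le> n" "k \<le> (k'::nat)"
      have "g s' k' \<le> g s' k" "g s' k \<le> g s k" "e s' k \<le> e s' k'" "e s k \<le> e s' k"
        using * antimonoD[OF g_mono_k[of s']] monotone_onD[OF g_mono_s, of s s' k]
          monoD[OF e_mono_k[of s']] monotone_onD[OF e_mono_s, of s s' k] by auto
      then show "r s' k' \<le> r s k"
        by (simp add: r reward_def)
    qed
  next
    fix s k i assume "s \<le> n" "i \<le> n"
    then show "0 \<le> ?P s k i"
      using lo_nonneg lo_le_up worst_row_bounds(1) by (meson order_trans)
  next
    fix s k assume s: "s \<le> n"
    then show "sum (?P s k) {0..n} = 1"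
      using total by (simp add: atLeast0AtMost)
    then show "?P s k \<in> U s k"
      using lo_le_up[OF s] worst_row_bounds[of _ n "lo s k" "up s k"]
      by (simp add: U interval_ambiguity_def)
  next
    fix s k p and f :: "nat \<Rightarrow> real"
    assume s: "s \<le> n" and p: "p \<in> U s k" and f: "antimono_on {0..n} f"
    show "(\<Sum>i=0..n. ?P s k i * f i) \<le> (\<Sum>i=0..n. p i * f i)"
    proof (rule expectation_antimono_le[OF f])
      fix i assume "i \<le> n"
      then show "sum (?P s k) {..i} \<le> sum p {..i}"
        unfolding cdf[OF s] using row[OF p] by (intro worst_cdf_le) auto
    qed (use total[OF s] row[OF p] in simp)
  next
    fix s s' k k' and f :: "nat \<Rightarrow> real"
    assume *: "s \<le> s'" "s' \<le> n" "k \<le> (k'::nat)" and f: "antimono_on {0..n} f"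
    then have s: "s \<le> n" by simp
    \<comment> \<open>The two dominance hypotheses are chained through the intermediate state
      \<open>(s', k)\<close>.\<close>
    have dom: "sum (lo s' k') {0..i} \<le> sum (lo s k) {0..i} \<and>
        sum (up s k) {i..n} \<le> sum (up s' k') {i..n}" if "i \<le> n" for i
      using that * dom_s[of i s s' k] dom_k[of i s' k k'] by fastforce
    show "(\<Sum>i=0..n. ?P s' k' i * f i) \<le> (\<Sum>i=0..n. ?P s k i * f i)"
    proof (rule expectation_antimono_le[OF f])
      fix i assume "i \<le> n"
      with dom show "sum (?P s' k') {..i} \<le> sum (?P s k) {..i}"
        unfolding cdf[OF s] cdf[OF *(2)] by (rule worst_cdf_mono)
    qed (simp add: total s *(2))
  qed (fact beta)+

  have w_eq: "w = action_value n r cr cs \<beta> U (robust_value n r cr cs \<beta> U)"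
    by (simp only: w V)
  have rem: "\<zeta> k' \<le> \<zeta> k"
    if drop: "\<forall>s\<in>{0..n}. \<forall>k. \<beta> * r 0 0 / (1 - \<beta>) - \<beta> * cs \<le> r s k - r s (k + 1)"
      and k: "k < k'" "k' < kstar" for k k'
  proof (rule control_limits_antimono[OF limits policy tie_breaking])
    \<comment> \<open>The limit \<open>\<zeta> kstar\<close> is at most \<open>n\<close>, so
      \<open>(n, kstar)\<close> is a scrapping state. Comparing with remanufacturing there, whose
      continuation value is at least \<open>cs\<close>, yields the bound on
      \<open>- cr\<close>.\<close>
    have "a n kstar = Scrap"
      using limits by (auto simp: control_limits_def not_less)
    then have "w n kstar Remanufacture \<le> w n kstar Scrap"
      using optimal_policy_ge[OF policy, where s = n and k = kstar and b = Remanufacture] by simp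
    then have "- cr + \<beta> * robust_value n r cr cs \<beta> U 0 (kstar + 1) \<le> cs"
      by (simp add: w_eq)
    moreover have "\<beta> * cs \<le> \<beta> * robust_value n r cr cs \<beta> U 0 (kstar + 1)"
      using scrap_le_value[of 0] beta by simp
    ultimately have "- cr \<le> (1 - \<beta>) * cs"
      by (simp add: algebra_simps)
    then show "w s k Remanufacture - w s k Continue \<le> w s k' Remanufacture - w s k' Continue"
      if "s \<le> n" for s
      unfolding w_eq using drop k that by (intro remanufacture_advantage_mono) auto
  qed (use k in auto)
  have scrap: "\<zeta> k' \<le> \<zeta> k" if k: "kstar \<le> k" "k \<le> k'" for k k'
  proof (rule control_limits_antimono[OF limits policy tie_breaking])
    \<comment> \<open>Scrapping pays the constant \<open>cs\<close>, so its advantage grows as the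
      value of continuing falls.\<close>
    show "w s k Scrap - w s k Continue \<le> w s k' Scrap - w s k' Continue" if "s \<le> n" for s
      using continue_value_mono[OF value_decreasing, of s s k k'] that k
      by (simp add: w_eq del: action_value.simps(1))
  qed (use k in auto)
  have "antimono_on {..<kstar} \<zeta>"
    if "\<forall>s\<in>{0..n}. \<forall>k. \<beta> * r 0 0 / (1 - \<beta>) - \<beta> * cs \<le> r s k - r s (k + 1)"
  proof (rule monotone_onI)
    fix k k' assume "k' \<in> {..<kstar}" "k \<le> k'"
    then show "\<zeta> k' \<le> \<zeta> k"
      using rem[OF that] by (cases "k = k'") auto
  qed
  moreover have "antimono_on {kstar..} \<zeta>"
    using scrap by (intro monotone_onI) auto
  ultimately show ?thesis
    by blast
qed

end
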